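(* Let $1\le p\le q$, let $(a\mid b)=(a_1,\dots,a_p\mid b_1,\dots,b_q)$ be a $\Delta^+(\mathfrak k,\mathfrak t)$-dominant weight for $Sp(p,q)$, and fix any $w\in W(\mathfrak g,\mathfrak t)^1$. For a $\Delta^+(\mathfrak k,\mathfrak t)$-dominant weight $\mu$ put $$D_w(\mu):=\|\{\mu-\rho_n^{(w)}\}+\rho_c\|^2-\|\mu\|_{\rm lambda}^2 .$$ (i) Fix $b$. If $a=\sum_t s_ta^{(t)}$ is a finite sum, where $s_t\ge0$, $\sum_t s_t=1$ and the $a^{(t)}$ are $p$-dimensional nonnegative integral vectors with components in decreasing (i.e. weakly decreasing) order, then $$D_w(a\mid b)\le\sum_t s_tD_w(a^{(t)}\mid b).$$ (ii) Fix $a$. If $b=\sum_t s_tb^{(t)}$ is a finite sum, where $s_t\ge0$, $\sum_t s_t=1$ and the $b^{(t)}$ are $q$-dimensional nonnegative integral vectors with components in decreasing (i.e. weakly decreasing) order, then $$D_w(a\mid b)\le\sum_t s_tD_w(a\mid b^{(t)}).$$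
   Context: Let $n=p+q$. Vectors in $\mathbb R^n$ are written $(a_1,\dots,a_p\mid b_1,\dots,b_q)$ and carry the Euclidean norm. A $\Delta^+(\mathfrak k,\mathfrak t)$-dominant weight is an integral vector with $a_1\ge\dots\ge a_p\ge0$ and $b_1\ge\dots\ge b_q\ge 0$. Put $\rho_c=(p,\dots,1\mid q,\dots,1)$, $\rho=(n,n-1,\dots,1)$, $\mathcal C=\{a_1\ge\dots\ge a_p\ge0,\ b_1\ge\dots\ge b_q\ge0\}$, $\mathcal C_{\mathfrak g}=\{z_1\ge\dots\ge z_n\ge0\}\subset\mathbb R^n$. $W(\mathfrak g,\mathfrak t)$ is the group of signed permutations of coordinates, $W(\mathfrak g,\mathfrak t)^1=\{w: w\mathcal C_{\mathfrak g}\subset\mathcal C\}$, $\mathcal C_w=w\mathcal C_{\mathfrak g}$, $\rho^{(w)}=w\rho$, $\rho_n^{(w)}=\rho^{(w)}-\rho_c$. For a vector $\eta$, $\{\eta\}$ is the unique $\Delta^+(\mathfrak k,\mathfrak t)$-dominant vector conjugate to $\eta$ under $W(\mathfrak k,\mathfrak t)$, i.e. obtained by taking absolute values of the coordinates and sorting each of the two blocks in decreasing order. The lambda norm: for a dominant weight $\mu$ choose $v\in W(\mathfrak g,\mathfrak t)^1$ with $\mu+2\rho_c\in\mathcal C_v$, and let $\lambda_a(\mu)$ be the unique point of $\mathcal C_v$ closest to $\mu+2\rho_c-\rho^{(v)}$ (independent of the choice of $v$); $\|\mu\|_{\rm lambda}=\|\lambda_a(\mu)\|$. *)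

theory Defs
  imports "HOL-Analysis.Analysis"
begin

(* The coordinates of R^p and R^q are indexed by arbitrary finite linear orders 'p and 'q with
   p and q elements, those of R^n by 'p + 'q. The following order on 'p + 'q puts all of the first
   block before the second, so that the k-th smallest index is the k-th coordinate of
   (a_1, ..., a_p | b_1, ..., b_q). *)
instantiation sum :: (linorder, linorder) linorder
begin

definition less_eq_sum :: "'a + 'b \<Rightarrow> 'a + 'b \<Rightarrow> bool" where
  "x \<le> y \<longleftrightarrow>
    (case x of
       Inl i \<Rightarrow> (case y of Inl j \<Rightarrow> i \<le> j | Inr _ \<Rightarrow> True)
     | Inr i \<Rightarrow> (case y of Inl _ \<Rightarrow> False | Inr j \<Rightarrow> i \<le> j))"

definition less_sum :: "'a + 'b \<Rightarrow> 'a + 'b \<Rightarrow> bool" where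
  "x < y \<longleftrightarrow> x \<le> y \<and> \<not> y \<le> (x :: 'a + 'b)"

instance
  by standard (auto simp: less_eq_sum_def less_sum_def split: sum.splits)

end

definition join :: "real ^ 'p::finite \<Rightarrow> real ^ 'q::finite \<Rightarrow> real ^ ('p + 'q)" where
  "join a b = (\<chi> k. case k of Inl i \<Rightarrow> a $ i | Inr j \<Rightarrow> b $ j)"

definition decreasing_nonneg :: "real ^ 'n::{finite,linorder} \<Rightarrow> bool" where
  "decreasing_nonneg z \<longleftrightarrow> (\<forall>i j. i \<le> j \<longrightarrow> z $ j \<le> z $ i) \<and> (\<forall>i. 0 \<le> z $ i)"

definition integral_vec :: "real ^ 'n::finite \<Rightarrow> bool" where
  "integral_vec z \<longleftrightarrow> (\<forall>i. z $ i \<in> \<int>)"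

definition chamber_k :: "(real ^ ('p::{finite,linorder} + 'q::{finite,linorder})) set" where
  "chamber_k = {z. \<exists>a b. z = join a b \<and> decreasing_nonneg a \<and> decreasing_nonneg b}"

definition dominant_weight :: "real ^ ('p::{finite,linorder} + 'q::{finite,linorder}) \<Rightarrow> bool" where
  "dominant_weight \<mu> \<longleftrightarrow> \<mu> \<in> chamber_k \<and> integral_vec \<mu>"

definition chamber_g :: "(real ^ ('p::{finite,linorder} + 'q::{finite,linorder})) set" where
  "chamber_g = {z. decreasing_nonneg z}"

(* (N, N - 1, ..., 1), where N is the number of coordinates *)
definition staircase :: "real ^ 'n::{finite,linorder}" where
  "staircase = (\<chi> i. real (card {i..}))"

definition rho :: "real ^ ('p::{finite,linorder} + 'q::{finite,linorder})" where
  "rho = staircase"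

definition rho_c :: "real ^ ('p::{finite,linorder} + 'q::{finite,linorder})" where
  "rho_c = join staircase staircase"

definition signed_perms :: "(real ^ 'n::finite \<Rightarrow> real ^ 'n) set" where
  "signed_perms =
    {w. \<exists>\<sigma> s. bij \<sigma> \<and> (\<forall>k. s k \<in> {-1, 1}) \<and> w = (\<lambda>z. \<chi> k. s k * z $ \<sigma> k)}"

definition W_g :: "(real ^ ('p::finite + 'q::finite) \<Rightarrow> real ^ ('p + 'q)) set" where
  "W_g = signed_perms"

(* every vector is a join, so u and v determine w *)
definition W_k :: "(real ^ ('p::finite + 'q::finite) \<Rightarrow> real ^ ('p + 'q)) set" where
  "W_k = {w. \<exists>u\<in>signed_perms. \<exists>v\<in>signed_perms. \<forall>a b. w (join a b) = join (u a) (v b)}"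

definition W1 ::
  "(real ^ ('p::{finite,linorder} + 'q::{finite,linorder}) \<Rightarrow> real ^ ('p + 'q)) set" where
  "W1 = {w \<in> W_g. w ` chamber_g \<subseteq> chamber_k}"

definition rho_n ::
  "(real ^ ('p::{finite,linorder} + 'q::{finite,linorder}) \<Rightarrow> real ^ ('p + 'q)) \<Rightarrow> real ^ ('p + 'q)"
  where "rho_n w = w rho - rho_c"

(* {eta}: take absolute values and sort each of the two blocks in decreasing order *)
definition dominant_conj ::
  "real ^ ('p::{finite,linorder} + 'q::{finite,linorder}) \<Rightarrow> real ^ ('p + 'q)" where
  "dominant_conj \<eta> = (THE \<zeta>. \<zeta> \<in> chamber_k \<and> (\<exists>w\<in>W_k. \<zeta> = w \<eta>))"

definition lambda_a ::
  "real ^ ('p::{finite,linorder} + 'q::{finite,linorder}) \<Rightarrow> real ^ ('p + 'q)" where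
  "lambda_a \<mu> =
    (let v = (SOME v. v \<in> W1 \<and> \<mu> + 2 *\<^sub>R rho_c \<in> v ` chamber_g)
     in closest_point (v ` chamber_g) (\<mu> + 2 *\<^sub>R rho_c - v rho))"

definition lambda_norm :: "real ^ ('p::{finite,linorder} + 'q::{finite,linorder}) \<Rightarrow> real" where
  "lambda_norm \<mu> = norm (lambda_a \<mu>)"

definition Dw ::
  "(real ^ ('p::{finite,linorder} + 'q::{finite,linorder}) \<Rightarrow> real ^ ('p + 'q)) \<Rightarrow>
    real ^ ('p + 'q) \<Rightarrow> real" where
  "Dw w \<mu> = (norm (dominant_conj (\<mu> - rho_n w) + rho_c))\<^sup>2 - (lambda_norm \<mu>)\<^sup>2"

end

theory Submission
  imports Defs
begin

text \<open>
  The function \<^term>\<open>Dw w\<close> is convex on the whole cone of \<open>\<mu>\<close> that are dominant for the compact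
  subgroup, in both blocks jointly; the two inequalities are Jensen's inequality for it along each
  of the blocks.

  Let \<open>m(y)\<close> be the maximum of \<open>y \<bullet> u \<rho>\<close> over all signed permutations \<open>u\<close>
  (\<^term>\<open>orbit_support\<close> below). As a maximum of linear functions it is convex, it is invariant under
  signed permutations, and by the rearrangement inequality \<open>m(y) = y \<bullet> v \<rho>\<close> when \<open>y\<close> lies in the
  chamber \<open>C_v\<close>.

  The lambda norm: put \<open>z = \<mu> + 2 \<rho>_c \<in> C_v\<close> and let \<open>\<lambda>\<close> be the point of \<open>C_v\<close> closest to
  \<open>z - v \<rho>\<close>. Projecting onto a cone gives \<open>(z - v \<rho> - \<lambda>) \<bullet> \<lambda> = 0\<close>, and expanding the squares turns
  this into \<open>|z|^2 - |\<lambda>|^2 = min_{y \<in> C_v} (|z - y|^2 + 2 m(y))\<close>. The minimum stays the same when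
  \<open>y\<close> ranges over the whole space: moving \<open>y\<close> into \<open>C_v\<close> by a signed permutation preserves \<open>m(y)\<close>
  and, by rearrangement, does not increase the distance to \<open>z\<close>. In this form the chamber has
  disappeared, and \<open>|z|^2 - |\<lambda>|^2\<close> is the partial minimum of a jointly convex function of \<open>(z, y)\<close>,
  hence convex in \<open>z\<close> across all chambers at once
  (\<open>closest_point_chamber\<close>, \<open>convex_on_partial_minimum\<close>, \<open>convex_on_lambda_deficit\<close>).

  The other norm: for \<open>\<eta> = (x | y)\<close> the vector \<open>{\<eta>}\<close> has the norm of \<open>\<eta>\<close>, and its inner product
  with \<open>\<rho>_c\<close> is \<open>m(x) + m(y)\<close>, where \<open>m\<close> is taken in each block separately. So
  \<open>|{\<eta>} + \<rho>_c|^2 = |\<eta>|^2 + 2 (m(x) + m(y)) + |\<rho>_c|^2\<close> (\<open>norm_dominant_conj_add_rho_c\<close>).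

  In the difference the quadratic term \<open>|\<mu> - \<rho>_n|^2 - |\<mu> + 2 \<rho>_c|^2\<close> is affine in \<open>\<mu>\<close>, and everything
  else is convex (\<open>convex_on_Dw\<close>).
\<close>

section \<open>Signed permutations\<close>

lemma signed_permsE:
  assumes "u \<in> signed_perms"
  obtains \<sigma> s where "bij \<sigma>" "\<And>k. s k \<in> {-1, 1}" "\<And>z k. u z $ k = s k * z $ \<sigma> k"
  using assms unfolding signed_perms_def by fastforce

lemma signed_permsI:
  assumes "bij \<sigma>" "\<And>k. s k \<in> {-1, 1}" "\<And>z k. u z $ k = s k * z $ \<sigma> k"
  shows "u \<in> signed_perms"
  unfolding signed_perms_def mem_Collect_eq
  by (rule exI[of _ \<sigma>], rule exI[of _ s]) (use assms in \<open>auto simp: vec_eq_iff fun_eq_iff\<close>)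

lemma linear_signed_perm:
  assumes "u \<in> signed_perms"
  shows "linear u"
  using assms by (elim signed_permsE, intro linearI) (auto simp: vec_eq_iff algebra_simps)

lemma inner_signed_perm:
  fixes u :: "real ^ 'n::finite \<Rightarrow> real ^ 'n"
  assumes "u \<in> signed_perms"
  shows "u x \<bullet> u y = x \<bullet> y"
proof -
  obtain \<sigma> s where u: "bij \<sigma>" "\<And>k. s k \<in> {-1, 1}" "\<And>z k. u z $ k = s k * z $ \<sigma> k"
    using assms by (rule signed_permsE) blast
  have "s k * s k = 1" for k
    using u(2)[of k] by auto
  then have *: "s k * c * (s k * d) = c * d" for k c d
    by (metis mult.assoc mult.commute mult_1)
  have "u x \<bullet> u y = (\<Sum>k\<in>UNIV. x $ \<sigma> k * y $ \<sigma> k)"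
    by (simp add: inner_vec_def u(3) *)
  also have "\<dots> = x \<bullet> y"
    unfolding inner_vec_def inner_real_def using u(1) by (rule sum.reindex_bij_betw)
  finally show ?thesis .
qed

lemma id_signed_perm: "id \<in> signed_perms"
  by (rule signed_permsI[of id "\<lambda>_. 1"]) auto

lemma comp_signed_perm:
  assumes "u \<in> signed_perms" "v \<in> signed_perms"
  shows "(\<lambda>x. u (v x)) \<in> signed_perms"
proof -
  obtain \<sigma> s where u: "bij \<sigma>" "\<And>k. s k \<in> {-1, 1}" "\<And>z k. u z $ k = s k * z $ \<sigma> k"
    using assms(1) by (rule signed_permsE) blast
  obtain \<tau> r where v: "bij \<tau>" "\<And>k. r k \<in> {-1, 1}" "\<And>z k. v z $ k = r k * z $ \<tau> k"
    using assms(2) by (rule signed_permsE) blast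
  have "s k * r (\<sigma> k) \<in> {-1, 1}" for k
    using u(2)[of k] v(2)[of "\<sigma> k"] by auto
  then show ?thesis
    using u v by (intro signed_permsI[of "\<tau> \<circ> \<sigma>" "\<lambda>k. s k * r (\<sigma> k)"]) (auto intro: bij_comp)
qed

lemma inverse_signed_perm:
  assumes "u \<in> signed_perms"
  obtains u' where "u' \<in> signed_perms" "\<And>x. u' (u x) = x" "\<And>x. u (u' x) = x"
proof -
  obtain \<sigma> s where u: "bij \<sigma>" "\<And>k. s k \<in> {-1, 1}" "\<And>z k. u z $ k = s k * z $ \<sigma> k"
    using assms by (rule signed_permsE) blast
  define u' where "u' z = (\<chi> k. s (inv \<sigma> k) * z $ inv \<sigma> k)" for z :: "real ^ 'a"
  have s: "s k * (s k * c) = c" for k c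
    using u(2)[of k] by auto
  have "u' \<in> signed_perms"
    using u by (intro signed_permsI[of "inv \<sigma>" "\<lambda>k. s (inv \<sigma> k)"]) (auto simp: u'_def bij_imp_bij_inv)
  moreover have "u' (u x) = x" for x
    using u(1) by (simp add: vec_eq_iff u'_def u(3) s bij_is_surj surj_f_inv_f)
  moreover have "u (u' x) = x" for x
    using u(1) by (simp add: vec_eq_iff u'_def u(3) s bij_is_inj inv_f_f)
  ultimately show ?thesis
    using that by blast
qed

lemma finite_signed_perms: "finite (signed_perms :: (real ^ 'n::finite \<Rightarrow> real ^ 'n) set)"
proof (rule finite_subset)
  let ?F = "\<lambda>(\<sigma> :: 'n \<Rightarrow> 'n, s :: 'n \<Rightarrow> real) z. \<chi> k. s k * z $ \<sigma> k"
  show "signed_perms \<subseteq> ?F ` (UNIV \<times> (UNIV \<rightarrow>\<^sub>E {-1, 1}))"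
    unfolding signed_perms_def by (auto simp: image_iff PiE_def extensional_def Pi_def)
  show "finite (?F ` (UNIV \<times> (UNIV \<rightarrow>\<^sub>E {-1, 1})))"
    by (intro finite_imageI finite_cartesian_product finite_PiE) auto
qed

section \<open>Dominant representatives and the rearrangement inequality\<close>

lemma staircase_strict_mono:
  fixes i j :: "'n::{finite,linorder}"
  assumes "i < j"
  shows "staircase $ j < staircase $ i"
proof -
  have "{j..} \<subset> {i..}"
    using assms by auto
  then show ?thesis
    by (simp add: staircase_def psubset_card_mono)
qed

lemma staircase_pos: "0 < staircase $ (i :: 'n::{finite,linorder})"
  by (auto simp: staircase_def card_gt_0_iff)

text \<open>
  All signs can be dropped because both vectors are nonnegative. Then the superlevel sets of \<open>u y\<close>
  and \<open>y\<close> have equal sizes, and they are initial segments of the indices because both vectors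
  decrease; initial segments of a linear order form a chain, so equal size forces equality.
\<close>
lemma dominant_unique:
  fixes y :: "real ^ 'n::{finite,linorder}"
  assumes u: "u \<in> signed_perms" and y: "decreasing_nonneg y" and uy: "decreasing_nonneg (u y)"
  shows "u y = y"
proof -
  obtain \<sigma> s where s: "bij \<sigma>" "\<And>k. s k \<in> {-1, 1}" "\<And>z k. u z $ k = s k * z $ \<sigma> k"
    using u by (rule signed_permsE) blast
  have coord: "u y $ k = y $ \<sigma> k" for k
  proof -
    have "0 \<le> u y $ k" "0 \<le> y $ \<sigma> k"
      using y uy by (auto simp: decreasing_nonneg_def)
    then show ?thesis
      using s(2)[of k] s(3)[of y k] by auto
  qed
  have level: "{k. c \<le> u y $ k} = {k. c \<le> y $ k}" (is "?A = ?B") for c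
  proof -
    have "?A = \<sigma> -` ?B"
      by (auto simp: coord)
    then have "card ?A = card ?B"
      using s(1) card_vimage_inj[of \<sigma> ?B] by (simp add: bij_is_inj bij_is_surj)
    moreover have "?A \<subseteq> ?B \<or> ?B \<subseteq> ?A"
    proof (rule ccontr)
      assume "\<not> (?A \<subseteq> ?B \<or> ?B \<subseteq> ?A)"
      then obtain i j where "i \<in> ?A" "i \<notin> ?B" "j \<in> ?B" "j \<notin> ?A"
        by blast
      moreover have "i \<le> j \<or> j \<le> i"
        by (rule linear)
      ultimately show False
        using y uy unfolding decreasing_nonneg_def mem_Collect_eq by (meson order_trans)
    qed
    ultimately show ?thesis
      by (metis card_subset_eq finite)
  qed
  have "u y $ k = y $ k" for k
    using level[of "u y $ k"] level[of "y $ k"] by (blast intro: antisym)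
  then show ?thesis
    by (simp add: vec_eq_iff)
qed

text \<open>
  If a strictly dominant \<open>x\<close> pairs with \<open>y\<close> at least as well as with every signed permutation of
  \<open>y\<close>, then comparing with one transposition shows that the corresponding coordinates of \<open>y\<close> are in
  the right order, and comparing with one sign change shows that the coordinate is nonnegative.
\<close>
lemma dominant_of_maximal_pairing:
  fixes x y :: "real ^ 'n::{finite,linorder}"
  assumes pos: "\<And>i. 0 < x $ i" and strict: "\<And>i j. i < j \<Longrightarrow> x $ j < x $ i"
    and max: "\<And>u. u \<in> signed_perms \<Longrightarrow> x \<bullet> u y \<le> x \<bullet> y"
  shows "decreasing_nonneg y"
  unfolding decreasing_nonneg_def
proof (intro conjI allI impI)
  fix i j :: 'n
  assume "i \<le> j"
  show "y $ j \<le> y $ i"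
  proof (cases "i = j")
    case False
    with \<open>i \<le> j\<close> have "x $ j < x $ i"
      by (intro strict) auto
    let ?\<tau> = "Transposition.transpose i j"
    define u :: "real ^ 'n::{finite,linorder} \<Rightarrow> real ^ 'n::{finite,linorder}" where "u z = (\<chi> k. z $ ?\<tau> k)" for z
    have "u \<in> signed_perms"
      by (rule signed_permsI[of ?\<tau> "\<lambda>_. 1"]) (auto simp: u_def)
    then have "x \<bullet> u y \<le> x \<bullet> y"
      by (rule max)
    then have "0 \<le> (\<Sum>k\<in>UNIV. x $ k * y $ k - x $ k * y $ ?\<tau> k)"
      by (simp add: inner_vec_def u_def sum_subtractf)
    also have "\<dots> = (\<Sum>k\<in>{i, j}. x $ k * y $ k - x $ k * y $ ?\<tau> k)"
      by (rule sum.mono_neutral_right) (auto simp: transpose_def)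
    also have "\<dots> = (x $ i - x $ j) * (y $ i - y $ j)"
      using False by (simp add: algebra_simps)
    finally show ?thesis
      using \<open>x $ j < x $ i\<close> by (simp add: zero_le_mult_iff)
  qed simp
next
  fix i :: 'n
  define u :: "real ^ 'n::{finite,linorder} \<Rightarrow> real ^ 'n::{finite,linorder}" where "u z = (\<chi> k. (if k = i then -1 else 1) * z $ k)" for z
  have "u \<in> signed_perms"
    by (rule signed_permsI[of id "\<lambda>k. if k = i then -1 else 1"]) (auto simp: u_def)
  then have "x \<bullet> u y \<le> x \<bullet> y"
    by (rule max)
  then have "0 \<le> (\<Sum>k\<in>UNIV. x $ k * y $ k - x $ k * ((if k = i then -1 else 1) * y $ k))"
    by (simp add: inner_vec_def u_def sum_subtractf)
  also have "\<dots> = (\<Sum>k\<in>{i}. x $ k * y $ k - x $ k * ((if k = i then -1 else 1) * y $ k))"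
    by (rule sum.mono_neutral_right) auto
  also have "\<dots> = 2 * x $ i * y $ i"
    by simp
  finally show "0 \<le> y $ i"
    using pos[of i] by (simp add: zero_le_mult_iff)
qed

lemma maximal_pairing_dominant:
  fixes x y :: "real ^ 'n::{finite,linorder}"
  assumes pos: "\<And>i. 0 < x $ i" and strict: "\<And>i j. i < j \<Longrightarrow> x $ j < x $ i"
  obtains u where "u \<in> signed_perms" "decreasing_nonneg (u y)"
    "\<And>u'. u' \<in> signed_perms \<Longrightarrow> x \<bullet> u' y \<le> x \<bullet> u y"
proof -
  let ?f = "\<lambda>u. x \<bullet> u y"
  have "signed_perms \<noteq> ({} :: (real ^ 'n::{finite,linorder} \<Rightarrow> real ^ 'n::{finite,linorder}) set)"
    using id_signed_perm by blast
  then obtain u where u: "u \<in> signed_perms" and "Max (?f ` signed_perms) = ?f u"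
    by (rule obtains_MAX[OF finite_signed_perms, where f = ?f])
  then have max: "x \<bullet> u' y \<le> x \<bullet> u y" if "u' \<in> signed_perms" for u'
    using that finite_signed_perms by (metis Max_ge finite_imageI image_eqI)
  have "decreasing_nonneg (u y)"
  proof (rule dominant_of_maximal_pairing[OF pos strict])
    show "x \<bullet> u' (u y) \<le> x \<bullet> u y" if "u' \<in> signed_perms" for u'
      using max[OF comp_signed_perm[OF that u]] .
  qed
  with u max show ?thesis
    using that by blast
qed

lemma dominant_exists:
  fixes y :: "real ^ 'n::{finite,linorder}"
  obtains u where "u \<in> signed_perms" "decreasing_nonneg (u y)"
  using maximal_pairing_dominant[OF staircase_pos staircase_strict_mono] by metis

text \<open>
  For a strictly dominant \<open>x\<close> the best signed permutation of \<open>y\<close> is dominant, so it is \<open>y\<close> itself by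
  uniqueness. A weakly dominant \<open>x\<close> is the limit of the strictly dominant vectors \<open>x + e \<rho>\<close>.
\<close>
lemma rearrangement:
  fixes x y :: "real ^ 'n::{finite,linorder}"
  assumes x: "decreasing_nonneg x" and y: "decreasing_nonneg y" and u: "u \<in> signed_perms"
  shows "x \<bullet> u y \<le> x \<bullet> y"
proof (rule tendsto_le)
  let ?x = "\<lambda>e. x + e *\<^sub>R staircase"
  show "\<forall>\<^sub>F e in at_right 0. ?x e \<bullet> u y \<le> ?x e \<bullet> y"
    using eventually_at_right_less
  proof eventually_elim
    case (elim e)
    have pos: "0 < ?x e $ i" for i
      using x elim staircase_pos[of i] by (auto simp: decreasing_nonneg_def intro!: add_nonneg_pos)
    have strict: "?x e $ j < ?x e $ i" if "i < j" for i j
      using x elim staircase_strict_mono[OF that] that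
      by (auto simp: decreasing_nonneg_def intro!: add_le_less_mono)
    obtain v where v: "v \<in> signed_perms" "decreasing_nonneg (v y)"
      "\<And>u'. u' \<in> signed_perms \<Longrightarrow> ?x e \<bullet> u' y \<le> ?x e \<bullet> v y"
      using maximal_pairing_dominant[OF pos strict] by metis
    then show ?case
      using dominant_unique[OF v(1) y v(2)] u by metis
  qed
  show "((\<lambda>e. ?x e \<bullet> u y) \<longlongrightarrow> x \<bullet> u y) (at_right 0)"
    by (auto intro!: tendsto_eq_intros)
  show "((\<lambda>e. ?x e \<bullet> y) \<longlongrightarrow> x \<bullet> y) (at_right 0)"
    by (auto intro!: tendsto_eq_intros)
qed simp

section \<open>The support function of the orbit of the staircase\<close>

text \<open>
  The support function of the convex hull of the orbit of \<open>\<rho>\<close>: the function \<open>m\<close> of the introduction.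
\<close>
definition orbit_support :: "real ^ 'n::{finite,linorder} \<Rightarrow> real" where
  "orbit_support y = Max ((\<lambda>u. y \<bullet> u staircase) ` signed_perms)"

lemma orbit_support_upper:
  "u \<in> signed_perms \<Longrightarrow> y \<bullet> u staircase \<le> orbit_support y"
  unfolding orbit_support_def by (intro Max_ge finite_imageI finite_signed_perms) auto

lemma orbit_support_le:
  assumes "\<And>u. u \<in> signed_perms \<Longrightarrow> y \<bullet> u staircase \<le> c"
  shows "orbit_support y \<le> c"
  unfolding orbit_support_def using finite_signed_perms id_signed_perm assms
  by (subst Max_le_iff) auto

lemma decreasing_nonneg_staircase: "decreasing_nonneg (staircase :: real ^ 'n::{finite,linorder})"
  unfolding decreasing_nonneg_def
  using staircase_pos staircase_strict_mono by (metis less_eq_real_def order_le_less)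

text \<open>
  The function is linear on each chamber. The right-hand side does not contain \<open>v\<close>, so this also
  gives the invariance under signed permutations.
\<close>
lemma orbit_support_image:
  fixes x :: "real ^ 'n::{finite,linorder}"
  assumes v: "v \<in> signed_perms" and x: "decreasing_nonneg x"
  shows "orbit_support (v x) = x \<bullet> staircase"
proof (rule antisym)
  show "orbit_support (v x) \<le> x \<bullet> staircase"
  proof (rule orbit_support_le)
    fix u :: "real ^ 'n::{finite,linorder} \<Rightarrow> real ^ 'n::{finite,linorder}"
    assume u: "u \<in> signed_perms"
    obtain v' where v': "v' \<in> signed_perms" "\<And>x. v' (v x) = x"
      using v by (rule inverse_signed_perm) blast
    have "v x \<bullet> u staircase = x \<bullet> v' (u staircase)"
      using inner_signed_perm[OF v'(1), of "v x" "u staircase"] v'(2) by simp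
    also have "\<dots> \<le> x \<bullet> staircase"
      using rearrangement[OF x decreasing_nonneg_staircase comp_signed_perm[OF v'(1) u]] .
    finally show "v x \<bullet> u staircase \<le> x \<bullet> staircase" .
  qed
  show "x \<bullet> staircase \<le> orbit_support (v x)"
    using orbit_support_upper[OF v, of "v x"] v by (simp add: inner_signed_perm)
qed

lemma orbit_support_dominant:
  assumes "u \<in> signed_perms" "decreasing_nonneg (u x)"
  shows "orbit_support x = u x \<bullet> staircase"
  using inverse_signed_perm[OF assms(1)] orbit_support_image[OF _ assms(2)] by metis

lemma convex_on_orbit_support:
  "convex_on UNIV (orbit_support :: real ^ 'n::{finite,linorder} \<Rightarrow> real)"
proof (rule convex_onI)
  fix t :: real and x y :: "real ^ 'n::{finite,linorder}"
  assume "0 < t" "t < 1"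
  show "orbit_support ((1 - t) *\<^sub>R x + t *\<^sub>R y) \<le> (1 - t) * orbit_support x + t * orbit_support y"
  proof (rule orbit_support_le)
    fix u :: "real ^ 'n::{finite,linorder} \<Rightarrow> real ^ 'n::{finite,linorder}"
    assume u: "u \<in> signed_perms"
    show "((1 - t) *\<^sub>R x + t *\<^sub>R y) \<bullet> u staircase \<le> (1 - t) * orbit_support x + t * orbit_support y"
      using orbit_support_upper[OF u, of x] orbit_support_upper[OF u, of y] \<open>0 < t\<close> \<open>t < 1\<close>
      by (simp add: inner_add_left add_mono)
  qed
qed simp

section \<open>The projection onto a chamber as a Moreau envelope\<close>

lemma closed_dominant: "closed {z :: real ^ 'n::{finite,linorder}. decreasing_nonneg z}"
  unfolding decreasing_nonneg_def Collect_conj_eq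
  by (intro closed_Int closed_Collect_all closed_Collect_imp closed_Collect_le open_Collect_const
      continuous_intros)

lemma convex_dominant: "convex {z :: real ^ 'n::{finite,linorder}. decreasing_nonneg z}"
  unfolding convex_def decreasing_nonneg_def by (auto intro!: add_mono mult_left_mono)

text \<open>
  On the chamber, \<open>|z - y|^2 + 2 m(y)\<close> differs from the squared distance of \<open>y\<close> to \<open>z - v \<rho>\<close> by a
  quantity independent of \<open>y\<close>, so \<open>l\<close> minimizes it there. Moving a point from outside into the
  chamber does not increase it, so \<open>l\<close> is a global minimizer.
\<close>
lemma closest_point_chamber:
  fixes z :: "real ^ 'n::{finite,linorder}"
  assumes v: "v \<in> signed_perms" and z: "z \<in> v ` {z. decreasing_nonneg z}"
  defines "l \<equiv> closest_point (v ` {z. decreasing_nonneg z}) (z - v staircase)"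
  shows closest_point_chamber_eq: "(norm z)\<^sup>2 - (norm l)\<^sup>2 = (norm (z - l))\<^sup>2 + 2 * orbit_support l"
    and closest_point_chamber_le:
      "(norm z)\<^sup>2 - (norm l)\<^sup>2 \<le> (norm (z - y))\<^sup>2 + 2 * orbit_support y"
proof -
  let ?C = "v ` {z. decreasing_nonneg z}"
  let ?x = "z - v staircase"
  have lin: "linear v"
    using v by (rule linear_signed_perm)
  obtain v' where v': "v' \<in> signed_perms" "\<And>x. v' (v x) = x"
    using v by (rule inverse_signed_perm) blast
  have closed: "closed ?C"
    using closed_dominant lin v'(2)
    by (intro closed_injective_linear_image) (auto intro: inj_on_inverseI)
  have convex: "convex ?C"
    using convex_dominant lin by (intro convex_linear_image)
  have l: "l \<in> ?C"
    unfolding l_def using z by (intro closest_point_in_set closed) auto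
  have cone: "c *\<^sub>R y \<in> ?C" if "y \<in> ?C" "0 \<le> c" for y c
  proof -
    from that obtain x where "decreasing_nonneg x" "y = v x"
      by blast
    with \<open>0 \<le> c\<close> show ?thesis
      by (intro image_eqI[of _ _ "c *\<^sub>R x"])
        (auto simp: linear_scale[OF lin] decreasing_nonneg_def mult_left_mono)
  qed
  have dot: "(?x - l) \<bullet> (y - l) \<le> 0" if "y \<in> ?C" for y
    unfolding l_def using closest_point_dot[OF convex closed that] .
  \<comment> \<open>Compare with the points \<open>2 l\<close> and \<open>0\<close> on the ray through \<open>l\<close>.\<close>
  have "(?x - l) \<bullet> l = 0"
    using dot[OF cone[OF l, of 2]] dot[OF cone[OF l, of 0]] by (simp add: scaleR_2)
  then have orth: "z \<bullet> l - v staircase \<bullet> l - l \<bullet> l = 0"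
    by (simp add: inner_diff_left)
  have supp: "orbit_support y = y \<bullet> v staircase" if "y \<in> ?C" for y
    using that v by (auto simp: orbit_support_image inner_signed_perm)
  show eq: "(norm z)\<^sup>2 - (norm l)\<^sup>2 = (norm (z - l))\<^sup>2 + 2 * orbit_support l"
    using orth supp[OF l]
    by (simp add: power2_norm_eq_inner inner_diff_left inner_diff_right inner_commute)
  have chamber: "(norm (z - l))\<^sup>2 + 2 * orbit_support l \<le> (norm (z - y))\<^sup>2 + 2 * orbit_support y"
    if y: "y \<in> ?C" for y
  proof -
    have "dist ?x l \<le> dist ?x y"
      unfolding l_def by (rule closest_point_le[OF closed y])
    then have "(norm (?x - l))\<^sup>2 \<le> (norm (?x - y))\<^sup>2"
      by (simp add: dist_norm)
    then show ?thesis
      using supp[OF y] supp[OF l]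
      by (simp add: power2_norm_eq_inner inner_diff_left inner_diff_right inner_commute)
  qed
  \<comment> \<open>For arbitrary \<open>y\<close>, the vector \<open>v x\<close> is a signed permutation of \<open>y\<close> that lies in the chamber.\<close>
  obtain u where u: "u \<in> signed_perms" "decreasing_nonneg (u y)"
    by (rule dominant_exists)
  obtain u' where u': "u' \<in> signed_perms" "\<And>x. u' (u x) = x"
    using u(1) by (rule inverse_signed_perm) blast
  define x where "x = u y"
  have x: "decreasing_nonneg x" "y = u' x"
    using u u' by (simp_all add: x_def)
  obtain z' where z': "decreasing_nonneg z'" "z = v z'"
    using z by blast
  have "z \<bullet> y = z' \<bullet> v' (u' x)"
    using inner_signed_perm[OF v'(1), of z y] v'(2) z'(2) x(2) by simp
  also have "\<dots> \<le> z' \<bullet> x"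
    by (rule rearrangement[OF z'(1) x(1) comp_signed_perm[OF v'(1) u'(1)]])
  also have "\<dots> = z \<bullet> v x"
    using v z'(2) by (simp add: inner_signed_perm)
  finally have "z \<bullet> y \<le> z \<bullet> v x" .
  moreover have "v x \<bullet> v x = y \<bullet> y"
    using v u'(1) x(2) by (simp add: inner_signed_perm)
  ultimately have "(norm (z - v x))\<^sup>2 \<le> (norm (z - y))\<^sup>2"
    by (simp add: power2_norm_eq_inner inner_diff_left inner_diff_right inner_commute)
  moreover have "orbit_support (v x) = orbit_support y"
    using v u'(1) x by (simp add: orbit_support_image)
  ultimately show "(norm z)\<^sup>2 - (norm l)\<^sup>2 \<le> (norm (z - y))\<^sup>2 + 2 * orbit_support y"
    unfolding eq using chamber[of "v x"] x(1) by (smt (verit) imageI mem_Collect_eq)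
qed

lemma convex_on_partial_minimum:
  fixes f :: "'a::real_vector \<Rightarrow> real" and g :: "'a \<times> 'b::real_vector \<Rightarrow> real"
  assumes S: "convex S" and g: "convex_on UNIV g"
    and attained: "\<And>x. x \<in> S \<Longrightarrow> \<exists>y. f x = g (x, y)"
    and lower: "\<And>x y. x \<in> S \<Longrightarrow> f x \<le> g (x, y)"
  shows "convex_on S f"
proof (rule convex_onI)
  fix t :: real and x1 x2
  assume t: "0 < t" "t < 1" and x: "x1 \<in> S" "x2 \<in> S"
  obtain y1 y2 where y: "f x1 = g (x1, y1)" "f x2 = g (x2, y2)"
    using attained x by meson
  let ?c = "\<lambda>a b. (1 - t) *\<^sub>R a + t *\<^sub>R b"
  have "?c x1 x2 \<in> S"
    using convexD[OF S x] t by simp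
  then have "f (?c x1 x2) \<le> g (?c x1 x2, ?c y1 y2)"
    by (rule lower)
  also have "\<dots> \<le> (1 - t) * g (x1, y1) + t * g (x2, y2)"
    using convex_onD[OF g, of t "(x1, y1)" "(x2, y2)"] t by simp
  finally show "f (?c x1 x2) \<le> (1 - t) * f x1 + t * f x2"
    by (simp add: y)
qed (fact S)


section \<open>The two blocks\<close>

lemma join_nth [simp]: "join a b $ Inl i = a $ i" "join a b $ Inr j = b $ j"
  by (simp_all add: join_def)

lemma join_cases:
  fixes z :: "real ^ ('p::finite + 'q::finite)"
  obtains a b where "z = join a b"
proof -
  have "z = join (\<chi> i. z $ Inl i) (\<chi> j. z $ Inr j)"
    by (simp add: vec_eq_iff join_def split: sum.split)
  then show ?thesis
    using that by blast
qed

lemma join_eq_iff [simp]: "join a b = join a' b' \<longleftrightarrow> a = a' \<and> b = b'"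
  by (metis join_nth vec_eq_iff)

lemma join_add: "join a b + join a' b' = join (a + a') (b + b')"
  by (simp add: vec_eq_iff join_def split: sum.split)

lemma join_scaleR: "c *\<^sub>R join a b = join (c *\<^sub>R a) (c *\<^sub>R b)"
  by (simp add: vec_eq_iff join_def split: sum.split)

lemma join_sum:
  assumes "(\<Sum>t\<in>T. s t) = 1"
  shows join_sum_left: "(\<Sum>t\<in>T. s t *\<^sub>R join (A t) b) = join (\<Sum>t\<in>T. s t *\<^sub>R A t) b"
    and join_sum_right: "(\<Sum>t\<in>T. s t *\<^sub>R join a (B t)) = join a (\<Sum>t\<in>T. s t *\<^sub>R B t)"
  using assms by (simp_all add: vec_eq_iff join_def sum_distrib_right[symmetric] split: sum.split)

lemma inner_join: "join a b \<bullet> join a' b' = a \<bullet> a' + b \<bullet> b'"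
  by (simp add: inner_vec_def UNIV_Plus_UNIV[symmetric] sum.Plus del: UNIV_Plus_UNIV)

lemma join_in_chamber_k [simp]:
  "join a b \<in> chamber_k \<longleftrightarrow> decreasing_nonneg a \<and> decreasing_nonneg b"
  by (auto simp: chamber_k_def)

lemma convex_chamber_k:
  "convex (chamber_k :: (real ^ ('p::{finite,linorder} + 'q::{finite,linorder})) set)"
proof (rule convexI)
  fix x y :: "real ^ ('p + 'q)" and u v :: real
  assume *: "x \<in> chamber_k" "y \<in> chamber_k" "0 \<le> u" "0 \<le> v" "u + v = 1"
  obtain a b a' b' where "x = join a b" "y = join a' b'"
    by (metis join_cases)
  with * show "u *\<^sub>R x + v *\<^sub>R y \<in> chamber_k"
    using convexD[OF convex_dominant, of a a' u v] convexD[OF convex_dominant, of b b' u v]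
    by (simp add: join_scaleR join_add)
qed

lemma dominant_conj_join:
  fixes a :: "real ^ 'p::{finite,linorder}" and b :: "real ^ 'q::{finite,linorder}"
  assumes u: "u \<in> signed_perms" and v: "v \<in> signed_perms"
    and dom: "decreasing_nonneg (u a)" "decreasing_nonneg (v b)"
  shows "dominant_conj (join a b) = join (u a) (v b)"
  unfolding dominant_conj_def
proof (rule the_equality)
  define w where "w z = join (u (\<chi> i. z $ Inl i)) (v (\<chi> j. z $ Inr j))" for z :: "real ^ ('p + 'q)"
  have "w (join x y) = join (u x) (v y)" for x y
    by (simp add: w_def)
  then have "w \<in> W_k" "join (u a) (v b) = w (join a b)"
    unfolding W_k_def using u v by auto
  then show "join (u a) (v b) \<in> chamber_k \<and> (\<exists>w\<in>W_k. join (u a) (v b) = w (join a b))"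
    using dom by (metis join_in_chamber_k)
next
  fix z :: "real ^ ('p + 'q)"
  assume z: "z \<in> chamber_k \<and> (\<exists>w\<in>W_k. z = w (join a b))"
  then obtain u' v' where *: "u' \<in> signed_perms" "v' \<in> signed_perms" "z = join (u' a) (v' b)"
    unfolding W_k_def by auto
  then have dom': "decreasing_nonneg (u' a)" "decreasing_nonneg (v' b)"
    using z by auto
  obtain ui where ui: "ui \<in> signed_perms" "\<And>x. ui (u x) = x"
    using u by (rule inverse_signed_perm) blast
  obtain vi where vi: "vi \<in> signed_perms" "\<And>x. vi (v x) = x"
    using v by (rule inverse_signed_perm) blast
  have "u' a = u a"
    using dominant_unique[OF comp_signed_perm[OF *(1) ui(1)] dom(1)] dom'(1) ui(2) by simp
  moreover have "v' b = v b"
    using dominant_unique[OF comp_signed_perm[OF *(2) vi(1)] dom(2)] dom'(2) vi(2) by simp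
  ultimately show "z = join (u a) (v b)"
    using * by simp
qed

text \<open>
  Sorting a block into a dominant one maximizes its pairing with the staircase, so the cross term is
  a sum of two support functions. This is what makes the first norm in \<^term>\<open>Dw\<close> convex.
\<close>
lemma norm_dominant_conj_add_rho_c:
  fixes a :: "real ^ 'p::{finite,linorder}" and b :: "real ^ 'q::{finite,linorder}"
  shows "(norm (dominant_conj (join a b) + rho_c))\<^sup>2 =
    (norm (join a b))\<^sup>2 + 2 * (orbit_support a + orbit_support b) +
    (norm (rho_c :: real ^ ('p + 'q)))\<^sup>2"
proof -
  obtain u where u: "u \<in> signed_perms" "decreasing_nonneg (u a)"
    by (rule dominant_exists)
  obtain v where v: "v \<in> signed_perms" "decreasing_nonneg (v b)"
    by (rule dominant_exists)
  have "orbit_support a = u a \<bullet> staircase" "orbit_support b = v b \<bullet> staircase"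
    using u v by (simp_all add: orbit_support_dominant)
  then show ?thesis
    by (simp add: dominant_conj_join[OF u(1) v(1) u(2) v(2)] rho_c_def power2_norm_eq_inner
        inner_join join_add inner_add_left inner_add_right inner_commute
        inner_signed_perm[OF u(1)] inner_signed_perm[OF v(1)])
qed

text \<open>
  This guarantees that the choice in \<^term>\<open>lambda_a\<close> is made from a nonempty set. Some signed
  permutation \<open>v\<close> maps a dominant vector to \<open>\<mu> + 2 \<rho>_c\<close>. Because of the shift by \<open>2 \<rho>_c\<close> the
  coordinates are positive and strictly decreasing in each block; hence \<open>v\<close> has no signs and its
  permutation is increasing on each block, so it maps all of the dominant chamber into the cone
  \<^term>\<open>chamber_k\<close>.
\<close>
lemma chamber_of_shifted_weight:
  fixes \<mu> :: "real ^ ('p::{finite,linorder} + 'q::{finite,linorder})"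
  assumes "\<mu> \<in> chamber_k"
  shows "\<exists>v\<in>W1. \<mu> + 2 *\<^sub>R rho_c \<in> v ` chamber_g"
proof -
  let ?z = "\<mu> + 2 *\<^sub>R rho_c"
  obtain a b where \<mu>: "\<mu> = join a b" and ab: "decreasing_nonneg a" "decreasing_nonneg b"
    using assms by (auto simp: chamber_k_def)
  have z: "?z = join (a + 2 *\<^sub>R staircase) (b + 2 *\<^sub>R staircase)"
    by (simp add: \<mu> rho_c_def join_scaleR join_add)
  obtain u where u: "u \<in> signed_perms" "decreasing_nonneg (u ?z)"
    by (rule dominant_exists)
  obtain v where v: "v \<in> signed_perms" "\<And>x. v (u x) = x"
    using u(1) by (rule inverse_signed_perm) blast
  obtain \<sigma> s where s: "bij \<sigma>" "\<And>k. s k \<in> {-1, 1}" "\<And>z k. v z $ k = s k * z $ \<sigma> k"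
    using v(1) by (rule signed_permsE) blast
  have pos: "0 < ?z $ k" for k
    using ab by (cases k) (auto simp: z decreasing_nonneg_def staircase_pos intro!: add_nonneg_pos)
  have zk: "?z $ k = s k * u ?z $ \<sigma> k" for k
    using s(3)[of "u ?z" k] v(2) by simp
  have sign: "s k = 1" for k
  proof -
    have "0 \<le> u ?z $ \<sigma> k"
      using u(2) by (simp add: decreasing_nonneg_def)
    moreover have "0 < s k * u ?z $ \<sigma> k"
      using pos[of k] zk[of k] by simp
    ultimately show ?thesis
      using s(2)[of k] by auto
  qed
  have order: "\<sigma> k \<le> \<sigma> l" if "?z $ l < ?z $ k" for k l
  proof (rule ccontr)
    assume "\<not> \<sigma> k \<le> \<sigma> l"
    then have "u ?z $ \<sigma> k \<le> u ?z $ \<sigma> l"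
      using u(2) by (simp add: decreasing_nonneg_def)
    then show False
      using that zk[of k] zk[of l] sign by simp
  qed
  have strict: "(c + 2 *\<^sub>R staircase) $ j < (c + 2 *\<^sub>R staircase) $ i"
    if "decreasing_nonneg c" "i < j" for c :: "real ^ 'n::{finite,linorder}" and i j
    using that staircase_strict_mono[OF that(2)]
    by (auto simp: decreasing_nonneg_def intro!: add_le_less_mono)
  have "v x \<in> chamber_k" if "x \<in> chamber_g" for x
  proof -
    have x: "decreasing_nonneg x"
      using that by (simp add: chamber_g_def)
    obtain c d where cd: "v x = join c d"
      by (rule join_cases)
    have vx: "v x $ k = x $ \<sigma> k" for k
      by (simp add: s(3) sign)
    have c: "c $ i = x $ \<sigma> (Inl i)" and d: "d $ j = x $ \<sigma> (Inr j)" for i j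
      using vx[of "Inl i"] vx[of "Inr j"] by (simp_all add: cd)
    have "\<sigma> (Inl i) \<le> \<sigma> (Inl j)" if "i \<le> j" for i j
      using order[of "Inl j" "Inl i"] strict[OF ab(1), of i j] that
      by (cases "i = j") (auto simp: z)
    moreover have "\<sigma> (Inr i) \<le> \<sigma> (Inr j)" if "i \<le> j" for i j
      using order[of "Inr j" "Inr i"] strict[OF ab(2), of i j] that
      by (cases "i = j") (auto simp: z)
    ultimately show ?thesis
      using x by (simp add: cd decreasing_nonneg_def c d)
  qed
  then have "v \<in> W1"
    using v(1) by (auto simp: W1_def W_g_def)
  moreover have "?z \<in> v ` chamber_g"
    using u(2) v(2)[of ?z] by (intro image_eqI[of _ _ "u ?z"]) (auto simp: chamber_g_def)
  ultimately show ?thesis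
    by blast
qed

lemma lambda_norm_envelope:
  fixes \<mu> :: "real ^ ('p::{finite,linorder} + 'q::{finite,linorder})"
  assumes "\<mu> \<in> chamber_k"
  defines "z \<equiv> \<mu> + 2 *\<^sub>R rho_c"
  shows lambda_norm_eq: "(norm z)\<^sup>2 - (lambda_norm \<mu>)\<^sup>2 =
      (norm (z - lambda_a \<mu>))\<^sup>2 + 2 * orbit_support (lambda_a \<mu>)"
    and lambda_norm_le: "(norm z)\<^sup>2 - (lambda_norm \<mu>)\<^sup>2 \<le> (norm (z - y))\<^sup>2 + 2 * orbit_support y"
proof -
  define v where "v = (SOME v. v \<in> W1 \<and> z \<in> v ` chamber_g)"
  have "\<exists>v. v \<in> W1 \<and> z \<in> v ` chamber_g"
    using chamber_of_shifted_weight[OF assms(1)] by (auto simp: z_def)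
  then have "v \<in> W1 \<and> z \<in> v ` chamber_g"
    unfolding v_def by (rule someI_ex)
  then have v: "v \<in> signed_perms" "z \<in> v ` {z. decreasing_nonneg z}"
    by (simp_all add: W1_def W_g_def chamber_g_def)
  have l: "lambda_a \<mu> = closest_point (v ` {z. decreasing_nonneg z}) (z - v staircase)"
    by (simp add: lambda_a_def v_def z_def chamber_g_def rho_def)
  show "(norm z)\<^sup>2 - (lambda_norm \<mu>)\<^sup>2 =
      (norm (z - lambda_a \<mu>))\<^sup>2 + 2 * orbit_support (lambda_a \<mu>)"
    unfolding lambda_norm_def l by (rule closest_point_chamber_eq[OF v])
  show "(norm z)\<^sup>2 - (lambda_norm \<mu>)\<^sup>2 \<le> (norm (z - y))\<^sup>2 + 2 * orbit_support y"
    unfolding lambda_norm_def l by (rule closest_point_chamber_le[OF v])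
qed

section \<open>Convexity\<close>

lemma convex_on_norm_squared: "convex_on UNIV (\<lambda>x :: 'a::real_inner. (norm x)\<^sup>2)"
proof (rule convex_onI)
  fix t :: real and x y :: 'a
  assume t: "0 < t" "t < 1"
  have "(1 - t) * (norm x)\<^sup>2 + t * (norm y)\<^sup>2 - (norm ((1 - t) *\<^sub>R x + t *\<^sub>R y))\<^sup>2 =
      t * (1 - t) * (norm (x - y))\<^sup>2"
    by (simp add: power2_norm_eq_inner inner_add_left inner_add_right inner_diff_left
        inner_diff_right inner_commute algebra_simps)
  moreover have "0 \<le> t * (1 - t) * (norm (x - y))\<^sup>2"
    using t by simp
  ultimately show "(norm ((1 - t) *\<^sub>R x + t *\<^sub>R y))\<^sup>2 \<le> (1 - t) * (norm x)\<^sup>2 + t * (norm y)\<^sup>2"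
    by linarith
qed simp

lemma convex_on_comp_affine:
  assumes f: "convex_on UNIV f" and S: "convex S" and l: "linear l"
  shows "convex_on S (\<lambda>x. f (l x + c))"
proof (rule convex_onI)
  fix t :: real and x y
  assume "0 < t" "t < 1"
  moreover have "l ((1 - t) *\<^sub>R x + t *\<^sub>R y) + c = (1 - t) *\<^sub>R (l x + c) + t *\<^sub>R (l y + c)"
    by (simp add: linear_add[OF l] linear_diff[OF l] linear_scale[OF l] algebra_simps)
  ultimately show "f (l ((1 - t) *\<^sub>R x + t *\<^sub>R y) + c) \<le> (1 - t) * f (l x + c) + t * f (l y + c)"
    using convex_onD[OF f, of t "l x + c" "l y + c"] by simp
qed (fact S)

lemma convex_on_lambda_deficit:
  "convex_on chamber_k (\<lambda>\<mu> :: real ^ ('p::{finite,linorder} + 'q::{finite,linorder}).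
    (norm (\<mu> + 2 *\<^sub>R rho_c))\<^sup>2 - (lambda_norm \<mu>)\<^sup>2)"
proof (rule convex_on_partial_minimum[OF convex_chamber_k])
  let ?g = "\<lambda>z :: (real ^ ('p + 'q)) \<times> (real ^ ('p + 'q)).
    (norm ((fst z - snd z) + 2 *\<^sub>R rho_c))\<^sup>2 + 2 * orbit_support (snd z + 0)"
  show "convex_on UNIV ?g"
    by (intro convex_on_add convex_on_cmul
        convex_on_comp_affine[OF convex_on_norm_squared]
        convex_on_comp_affine[OF convex_on_orbit_support])
      (auto intro!: linearI simp: algebra_simps)
  fix \<mu> :: "real ^ ('p + 'q)"
  assume "\<mu> \<in> chamber_k"
  note env = lambda_norm_envelope[OF this]
  show "\<exists>y. (norm (\<mu> + 2 *\<^sub>R rho_c))\<^sup>2 - (lambda_norm \<mu>)\<^sup>2 = ?g (\<mu>, y)"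
    using env(1) by (intro exI[of _ "lambda_a \<mu>"]) (simp add: algebra_simps)
  show "(norm (\<mu> + 2 *\<^sub>R rho_c))\<^sup>2 - (lambda_norm \<mu>)\<^sup>2 \<le> ?g (\<mu>, y)" for y
    using env(2)[of y] by (simp add: algebra_simps)
qed

text \<open>
  The two squared norms expand to \<open>|\<mu>|^2\<close> with opposite signs, which leaves the affine function \<open>?A\<close>.
\<close>
lemma convex_on_Dw:
  fixes w :: "real ^ ('p::{finite,linorder} + 'q::{finite,linorder}) \<Rightarrow> real ^ ('p + 'q)"
  shows "convex_on chamber_k (Dw w)"
proof -
  define r where "r = rho_n w"
  define c where "c = 2 *\<^sub>R (rho_c :: real ^ ('p + 'q))"
  let ?l = "\<lambda>z :: real ^ ('p + 'q). \<chi> i. z $ Inl i"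
  let ?r = "\<lambda>z :: real ^ ('p + 'q). \<chi> j. z $ Inr j"
  let ?A = "\<lambda>\<mu>. - 2 * (\<mu> \<bullet> (r + c)) + ((norm r)\<^sup>2 - (norm c)\<^sup>2 + (norm (rho_c :: real ^ ('p + 'q)))\<^sup>2)"
  have eq: "Dw w \<mu> = ?A \<mu> + 2 * (orbit_support (?l \<mu> + ?l (- r)) + orbit_support (?r \<mu> + ?r (- r)))
      + ((norm (\<mu> + c))\<^sup>2 - (lambda_norm \<mu>)\<^sup>2)" for \<mu>
  proof -
    have join: "join (?l (\<mu> - r)) (?r (\<mu> - r)) = \<mu> - r"
      by (simp add: vec_eq_iff join_def split: sum.split)
    have "(norm (dominant_conj (\<mu> - r) + rho_c))\<^sup>2 = (norm (\<mu> - r))\<^sup>2 +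
        2 * (orbit_support (?l (\<mu> - r)) + orbit_support (?r (\<mu> - r))) + (norm (rho_c :: real ^ ('p + 'q)))\<^sup>2"
      using norm_dominant_conj_add_rho_c[of "?l (\<mu> - r)" "?r (\<mu> - r)"] unfolding join .
    moreover have "?l (\<mu> - r) = ?l \<mu> + ?l (- r)" "?r (\<mu> - r) = ?r \<mu> + ?r (- r)"
      by (simp_all add: vec_eq_iff)
    ultimately show ?thesis
      by (simp add: Dw_def r_def[symmetric] power2_norm_eq_inner inner_add_left inner_add_right
          inner_diff_left inner_diff_right inner_commute algebra_simps)
  qed
  have A: "convex_on chamber_k ?A"
    by (rule convex_on_comp_affine[of "\<lambda>x. x"])
      (auto intro!: linearI simp: convex_chamber_k inner_add_left algebra_simps convex_on_def)
  have L: "convex_on chamber_k (\<lambda>\<mu>. orbit_support (?l \<mu> + ?l (- r)))"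
    by (rule convex_on_comp_affine[OF convex_on_orbit_support convex_chamber_k])
      (auto intro!: linearI simp: vec_eq_iff)
  have R: "convex_on chamber_k (\<lambda>\<mu>. orbit_support (?r \<mu> + ?r (- r)))"
    by (rule convex_on_comp_affine[OF convex_on_orbit_support convex_chamber_k])
      (auto intro!: linearI simp: vec_eq_iff)
  have "convex_on chamber_k (\<lambda>\<mu>. ?A \<mu> +
      2 * (orbit_support (?l \<mu> + ?l (- r)) + orbit_support (?r \<mu> + ?r (- r)))
      + ((norm (\<mu> + c))\<^sup>2 - (lambda_norm \<mu>)\<^sup>2))"
    unfolding c_def
    by (intro convex_on_add[OF convex_on_add[OF A[unfolded c_def]
            convex_on_cmul[OF _ convex_on_add[OF L R]]] convex_on_lambda_deficit]) simp
  then show ?thesis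
    by (simp only: eq[symmetric])
qed

lemma Dw_convex_combination:
  fixes w :: "real ^ ('p::{finite,linorder} + 'q::{finite,linorder}) \<Rightarrow> real ^ ('p + 'q)"
  assumes "finite T" "(\<Sum>t\<in>T. s t) = 1" "\<And>t. t \<in> T \<Longrightarrow> 0 \<le> s t"
    and "\<And>t. t \<in> T \<Longrightarrow> \<mu> t \<in> chamber_k"
  shows "Dw w (\<Sum>t\<in>T. s t *\<^sub>R \<mu> t) \<le> (\<Sum>t\<in>T. s t * Dw w (\<mu> t))"
proof -
  have "T \<noteq> {}"
    using assms(2) by auto
  then show ?thesis
    using assms convex_chamber_k by (intro convex_on_sum[OF _ _ convex_on_Dw]) auto
qed

theorem proposition4p1:
  fixes a :: "real ^ 'p::{finite,linorder}"
    and b :: "real ^ 'q::{finite,linorder}"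
    and w :: "real ^ ('p + 'q) \<Rightarrow> real ^ ('p + 'q)"
  assumes "1 \<le> CARD('p)" and "CARD('p) \<le> CARD('q)"
    and "dominant_weight (join a b)"
    and "w \<in> W1"
  shows "(\<forall>(T :: 't set) (s :: 't \<Rightarrow> real) (A :: 't \<Rightarrow> real ^ 'p::{finite,linorder}).
           finite T \<and> (\<forall>t\<in>T. 0 \<le> s t) \<and> (\<Sum>t\<in>T. s t) = 1 \<and>
           (\<forall>t\<in>T. decreasing_nonneg (A t) \<and> integral_vec (A t)) \<and>
           a = (\<Sum>t\<in>T. s t *\<^sub>R A t)
           \<longrightarrow> Dw w (join a b) \<le> (\<Sum>t\<in>T. s t * Dw w (join (A t) b))) \<and>
         (\<forall>(T :: 't set) (s :: 't \<Rightarrow> real) (B :: 't \<Rightarrow> real ^ 'q::{finite,linorder}).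
           finite T \<and> (\<forall>t\<in>T. 0 \<le> s t) \<and> (\<Sum>t\<in>T. s t) = 1 \<and>
           (\<forall>t\<in>T. decreasing_nonneg (B t) \<and> integral_vec (B t)) \<and>
           b = (\<Sum>t\<in>T. s t *\<^sub>R B t)
           \<longrightarrow> Dw w (join a b) \<le> (\<Sum>t\<in>T. s t * Dw w (join a (B t))))"
proof -
  have ab: "decreasing_nonneg a" "decreasing_nonneg b"
    using assms(3) by (auto simp: dominant_weight_def)
  show ?thesis
  proof (intro conjI allI impI; elim conjE)
    fix T :: "'t set" and s and A :: "'t \<Rightarrow> real ^ 'p::{finite,linorder}"
    assume T: "finite T" "\<forall>t\<in>T. 0 \<le> s t" "(\<Sum>t\<in>T. s t) = 1"
      and A: "\<forall>t\<in>T. decreasing_nonneg (A t) \<and> integral_vec (A t)" "a = (\<Sum>t\<in>T. s t *\<^sub>R A t)"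
    show "Dw w (join a b) \<le> (\<Sum>t\<in>T. s t * Dw w (join (A t) b))"
      using Dw_convex_combination[OF T(1,3), of "\<lambda>t. join (A t) b" w] T A ab
      by (simp add: join_sum_left)
  next
    fix T :: "'t set" and s and B :: "'t \<Rightarrow> real ^ 'q::{finite,linorder}"
    assume T: "finite T" "\<forall>t\<in>T. 0 \<le> s t" "(\<Sum>t\<in>T. s t) = 1"
      and B: "\<forall>t\<in>T. decreasing_nonneg (B t) \<and> integral_vec (B t)" "b = (\<Sum>t\<in>T. s t *\<^sub>R B t)"
    show "Dw w (join a b) \<le> (\<Sum>t\<in>T. s t * Dw w (join a (B t)))"
      using Dw_convex_combination[OF T(1,3), of "\<lambda>t. join a (B t)" w] T B ab
      by (simp add: join_sum_right)
  qed
qed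

end
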